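(* Let $k,a$ be positive integers and let $(G_{k,n})_{n\ge 0}$ be the Generalized $k$-Pell sequence with $G_{k,0}=G_{k,1}=a$. Then for every integer $n\ge 1$, \[G_{k,n-1}G_{k,n+1}-G_{k,n}^2=a^2(-k)^{n-1}(1+k).\]
   Context: For positive integers $k,a$, the Generalized $k$-Pell sequence $(G_{k,n})_{n\ge 0}$ is the integer sequence defined by $G_{k,0}=G_{k,1}=a$ and $G_{k,n}=2G_{k,n-1}+kG_{k,n-2}$ for $n\ge 2$. *)

theory Defs
  imports Main
begin

fun gen_pell :: "int \<Rightarrow> int \<Rightarrow> nat \<Rightarrow> int" where
  "gen_pell k a 0 = a"
| "gen_pell k a (Suc 0) = a"
| "gen_pell k a (Suc (Suc n)) = 2 * gen_pell k a (Suc n) + k * gen_pell k a n"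

end

theory Submission
  imports Defs
begin

text \<open>Write \<open>x, y, z\<close> for consecutive terms and \<open>w = 2 * z + k * y\<close> for the next one. Then
  \<open>y * w - z^2 = z * (2 * y - z) + k * y^2\<close>, and \<open>2 * y - z = - k * x\<close> by the recurrence, so moving
  along the sequence by one index multiplies \<open>x * z - y^2\<close> by \<open>- k\<close>. In matrix terms this expression
  is a determinant of consecutive terms, and \<open>- k\<close> is the determinant of the companion matrix.\<close>

lemma gen_pell_cassini_step:
  "gen_pell k a (Suc m) * gen_pell k a (Suc (Suc (Suc m))) - (gen_pell k a (Suc (Suc m)))^2
   = - k * (gen_pell k a m * gen_pell k a (Suc (Suc m)) - (gen_pell k a (Suc m))^2)"
  by (simp add: power2_eq_square algebra_simps)

lemma gen_pell_cassini:
  "gen_pell k a m * gen_pell k a (Suc (Suc m)) - (gen_pell k a (Suc m))^2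
   = a^2 * (- k)^m * (1 + k)"
proof (induction m)
  case 0
  show ?case by (simp add: power2_eq_square algebra_simps)
next
  case (Suc m)
  show ?case
    unfolding gen_pell_cassini_step Suc.IH by simp
qed

theorem theorem2p5:
  fixes k a :: int and n :: nat
  assumes "k > 0" and "a > 0" and "n \<ge> 1"
  shows "gen_pell k a (n - 1) * gen_pell k a (n + 1) - (gen_pell k a n)^2
         = a^2 * (- k)^(n - 1) * (1 + k)"
  using gen_pell_cassini[of k a "n - 1"] assms(3)
  by (simp del: gen_pell.simps)

end
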